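(* A commutative ring $R$ is a $\tau_q$-von Neumann regular ring if and only if $R$ is reduced and $q\text{-}\dim(R)=0$.
   Context: All rings are commutative with identity. An ideal $I$ of $R$ is dense if $(0:_R I)=0$, and semi-regular if it contains a finitely generated dense ideal of $R$. Let $\mathcal{Q}$ be the set of all finitely generated semi-regular ideals of $R$. For an ideal $I$ of $R$ put $I_q=\{x\in \mathrm{E}_R(R)\mid Jx\subseteq I \text{ for some } J\in\mathcal{Q}\}$, where $\mathrm{E}_R(R)$ is the injective envelope of $R$ as an $R$-module. The ideal $I$ is a $q$-ideal if $I_q\cap R=I$. A maximal $q$-ideal is an ideal maximal among the proper $q$-ideals of $R$; the set of maximal $q$-ideals is denoted $q\text{-}\mathrm{Max}(R)$. It coincides with the set of ideals maximal among the non-semi-regular ideals of $R$, and consists of prime ideals. (A prime ideal is a $q$-ideal if and only if it is not semi-regular.) The $q$-Krull dimension of $R$ is $q\text{-}\dim(R)=\sup\{\mathrm{ht}(\mathfrak{p})\mid \mathfrak{p}\in q\text{-}\mathrm{Max}(R)\}$. The ring $R$ is called $\tau_q$-von Neumann regular if the localization $R_{\mathfrak{m}}$ is a von Neumann regular ring for every $\mathfrak{m}\in q\text{-}\mathrm{Max}(R)$. *)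

theory Defs
  imports "HOL-Algebra.Algebra" "HOL-Library.Extended_Nat"
begin

section \<open>Modules and injective envelopes\<close>

definition module_hom ::
  "('a, 'r) ring_scheme \<Rightarrow> ('a, 'b, 'm) module_scheme \<Rightarrow> ('a, 'c, 'n) module_scheme \<Rightarrow> ('b \<Rightarrow> 'c) set"
  where "module_hom R M N =
    {f. f \<in> carrier M \<rightarrow> carrier N \<and>
        (\<forall>x\<in>carrier M. \<forall>y\<in>carrier M. f (x \<oplus>\<^bsub>M\<^esub> y) = f x \<oplus>\<^bsub>N\<^esub> f y) \<and>
        (\<forall>r\<in>carrier R. \<forall>x\<in>carrier M. f (r \<odot>\<^bsub>M\<^esub> x) = r \<odot>\<^bsub>N\<^esub> f x)}"

definition regular_module :: "('a, 'r) ring_scheme \<Rightarrow> ('a, 'a) module"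
  where "regular_module R =
    \<lparr>carrier = carrier R, monoid.mult = (\<otimes>\<^bsub>R\<^esub>), one = \<one>\<^bsub>R\<^esub>,
     ring.zero = \<zero>\<^bsub>R\<^esub>, add = (\<oplus>\<^bsub>R\<^esub>), smult = (\<otimes>\<^bsub>R\<^esub>)\<rparr>"

text \<open>
  A definition in HOL cannot quantify over types, so the lifting property is required for all
  monomorphisms between modules whose underlying sets live in the type of the elements of the
  ring. This universe contains the ring and all its ideals, so by Baer's criterion the property
  then holds for modules of every type.
\<close>

definition injective_module :: "('a, 'r) ring_scheme \<Rightarrow> ('a, 'e, 'm) module_scheme \<Rightarrow> bool"
  where "injective_module R E \<longleftrightarrow>
    module R E \<and>
    (\<forall>(M :: ('a, 'a) module) (N :: ('a, 'a) module) f g.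
       module R M \<and> module R N \<and> f \<in> module_hom R M N \<and> inj_on f (carrier M) \<and>
       g \<in> module_hom R M E \<longrightarrow>
       (\<exists>h\<in>module_hom R N E. \<forall>x\<in>carrier M. h (f x) = g x))"

definition essential_mono ::
  "('a, 'r) ring_scheme \<Rightarrow> ('a, 'b, 'm) module_scheme \<Rightarrow> ('a, 'e, 'n) module_scheme \<Rightarrow> ('b \<Rightarrow> 'e) \<Rightarrow> bool"
  where "essential_mono R M E \<iota> \<longleftrightarrow>
    \<iota> \<in> module_hom R M E \<and> inj_on \<iota> (carrier M) \<and>
    (\<forall>N. submodule N R E \<and> N \<noteq> {\<zero>\<^bsub>E\<^esub>} \<longrightarrow> N \<inter> \<iota> ` carrier M \<noteq> {\<zero>\<^bsub>E\<^esub>})"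

text \<open>
  The injective envelope is determined only up to isomorphism over the module, so it is treated
  as a module \<open>E\<close> together with the embedding \<open>\<iota>\<close>; the inclusion of the ring into its
  envelope is \<open>\<iota>\<close> throughout.
\<close>

definition injective_envelope ::
  "('a, 'r) ring_scheme \<Rightarrow> ('a, 'b, 'm) module_scheme \<Rightarrow> ('a, 'e, 'n) module_scheme \<Rightarrow> ('b \<Rightarrow> 'e) \<Rightarrow> bool"
  where "injective_envelope R M E \<iota> \<longleftrightarrow>
    module R M \<and> injective_module R E \<and> essential_mono R M E \<iota>"


section \<open>Semi-regular ideals and q-ideals\<close>

definition annihilator :: "('a, 'r) ring_scheme \<Rightarrow> 'a set \<Rightarrow> 'a set"
  where "annihilator R I = {r \<in> carrier R. \<forall>x\<in>I. r \<otimes>\<^bsub>R\<^esub> x = \<zero>\<^bsub>R\<^esub>}"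

definition dense_ideal :: "('a, 'r) ring_scheme \<Rightarrow> 'a set \<Rightarrow> bool"
  where "dense_ideal R I \<longleftrightarrow> ideal I R \<and> annihilator R I = {\<zero>\<^bsub>R\<^esub>}"

definition fg_ideal :: "('a, 'r) ring_scheme \<Rightarrow> 'a set \<Rightarrow> bool"
  where "fg_ideal R I \<longleftrightarrow> (\<exists>A. finite A \<and> A \<subseteq> carrier R \<and> I = genideal R A)"

definition semi_regular_ideal :: "('a, 'r) ring_scheme \<Rightarrow> 'a set \<Rightarrow> bool"
  where "semi_regular_ideal R I \<longleftrightarrow>
    ideal I R \<and> (\<exists>J. J \<subseteq> I \<and> fg_ideal R J \<and> dense_ideal R J)"

definition fg_semi_regular_ideals :: "('a, 'r) ring_scheme \<Rightarrow> 'a set set"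
  where "fg_semi_regular_ideals R = {J. fg_ideal R J \<and> semi_regular_ideal R J}"

definition q_closure ::
  "('a, 'r) ring_scheme \<Rightarrow> ('a, 'e, 'm) module_scheme \<Rightarrow> ('a \<Rightarrow> 'e) \<Rightarrow> 'a set \<Rightarrow> 'e set"
  where "q_closure R E \<iota> I =
    {x \<in> carrier E. \<exists>J\<in>fg_semi_regular_ideals R. \<forall>j\<in>J. j \<odot>\<^bsub>E\<^esub> x \<in> \<iota> ` I}"

definition q_ideal ::
  "('a, 'r) ring_scheme \<Rightarrow> ('a, 'e, 'm) module_scheme \<Rightarrow> ('a \<Rightarrow> 'e) \<Rightarrow> 'a set \<Rightarrow> bool"
  where "q_ideal R E \<iota> I \<longleftrightarrow>
    ideal I R \<and> q_closure R E \<iota> I \<inter> \<iota> ` carrier R = \<iota> ` I"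

definition q_Max ::
  "('a, 'r) ring_scheme \<Rightarrow> ('a, 'e, 'm) module_scheme \<Rightarrow> ('a \<Rightarrow> 'e) \<Rightarrow> 'a set set"
  where "q_Max R E \<iota> =
    {M. q_ideal R E \<iota> M \<and> M \<noteq> carrier R \<and>
        (\<forall>N. q_ideal R E \<iota> N \<and> N \<noteq> carrier R \<and> M \<subseteq> N \<longrightarrow> N = M)}"


section \<open>Height and q-Krull dimension\<close>

definition height :: "('a, 'r) ring_scheme \<Rightarrow> 'a set \<Rightarrow> enat"
  where "height R p =
    Sup {enat n | n. \<exists>P. (\<forall>i\<le>n. primeideal (P i) R) \<and> (\<forall>i<n. P i \<subset> P (Suc i)) \<and> P n = p}"

text \<open>
  In \<^typ>\<open>enat\<close> the supremum of the empty set is 0; the set of maximal q-ideals is empty only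
  for the zero ring.
\<close>

definition q_dim ::
  "('a, 'r) ring_scheme \<Rightarrow> ('a, 'e, 'm) module_scheme \<Rightarrow> ('a \<Rightarrow> 'e) \<Rightarrow> enat"
  where "q_dim R E \<iota> = (SUP p\<in>q_Max R E \<iota>. height R p)"


section \<open>Localization\<close>

text \<open>
  The pair \<open>(a, s)\<close> stands for the fraction \<open>a / s\<close>. Operations on classes are unions over
  representatives, a union of equal classes whenever \<open>S\<close> is multiplicative.
\<close>

definition fraction_rel :: "('a, 'r) ring_scheme \<Rightarrow> 'a set \<Rightarrow> (('a \<times> 'a) \<times> ('a \<times> 'a)) set"
  where "fraction_rel R S =
    {((a, s), (b, t)). a \<in> carrier R \<and> s \<in> S \<and> b \<in> carrier R \<and> t \<in> S \<and>
       (\<exists>u\<in>S. u \<otimes>\<^bsub>R\<^esub> ((a \<otimes>\<^bsub>R\<^esub> t) \<ominus>\<^bsub>R\<^esub> (b \<otimes>\<^bsub>R\<^esub> s)) = \<zero>\<^bsub>R\<^esub>)}"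

definition fraction :: "('a, 'r) ring_scheme \<Rightarrow> 'a set \<Rightarrow> 'a \<Rightarrow> 'a \<Rightarrow> ('a \<times> 'a) set"
  where "fraction R S a s = fraction_rel R S `` {(a, s)}"

definition localization :: "('a, 'r) ring_scheme \<Rightarrow> 'a set \<Rightarrow> ('a \<times> 'a) set ring"
  where "localization R S =
    \<lparr>carrier = (carrier R \<times> S) // fraction_rel R S,
     monoid.mult = (\<lambda>V W. \<Union>(a, s)\<in>V. \<Union>(b, t)\<in>W. fraction R S (a \<otimes>\<^bsub>R\<^esub> b) (s \<otimes>\<^bsub>R\<^esub> t)),
     one = fraction R S \<one>\<^bsub>R\<^esub> \<one>\<^bsub>R\<^esub>,
     ring.zero = fraction R S \<zero>\<^bsub>R\<^esub> \<one>\<^bsub>R\<^esub>,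
     add = (\<lambda>V W. \<Union>(a, s)\<in>V. \<Union>(b, t)\<in>W.
              fraction R S ((a \<otimes>\<^bsub>R\<^esub> t) \<oplus>\<^bsub>R\<^esub> (b \<otimes>\<^bsub>R\<^esub> s)) (s \<otimes>\<^bsub>R\<^esub> t))\<rparr>"

definition localization_at :: "('a, 'r) ring_scheme \<Rightarrow> 'a set \<Rightarrow> ('a \<times> 'a) set ring"
  where "localization_at R p = localization R (carrier R - p)"


section \<open>Regularity and reducedness\<close>

definition von_neumann_regular :: "('a, 'r) ring_scheme \<Rightarrow> bool"
  where "von_neumann_regular R \<longleftrightarrow>
    cring R \<and> (\<forall>a\<in>carrier R. \<exists>x\<in>carrier R. a = a \<otimes>\<^bsub>R\<^esub> x \<otimes>\<^bsub>R\<^esub> a)"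

definition reduced_ring :: "('a, 'r) ring_scheme \<Rightarrow> bool"
  where "reduced_ring R \<longleftrightarrow>
    (\<forall>x\<in>carrier R. \<forall>n::nat. x [^]\<^bsub>R\<^esub> n = \<zero>\<^bsub>R\<^esub> \<longrightarrow> x = \<zero>\<^bsub>R\<^esub>)"

definition tau_q_von_neumann_regular ::
  "('a, 'r) ring_scheme \<Rightarrow> ('a, 'e, 'm) module_scheme \<Rightarrow> ('a \<Rightarrow> 'e) \<Rightarrow> bool"
  where "tau_q_von_neumann_regular R E \<iota> \<longleftrightarrow>
    (\<forall>m\<in>q_Max R E \<iota>. von_neumann_regular (localization_at R m))"

end

theory Submission
  imports Defs
begin

text \<open>
  Membership of a ring element in the q-closure can be tested inside \<open>R\<close>, so the maximal q-ideals
  are the ideals maximal among those containing no finite dense set, and they are prime because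
  products of dense sets are dense. If all localizations are regular and \<open>x\<close> is nilpotent, then
  \<open>Ann x\<close> lies in no maximal q-ideal, so it contains a finite dense set and \<open>x = 0\<close>; a regular
  localization at a prime also forces that prime to be minimal. Conversely, for a minimal prime
  \<open>p\<close> and \<open>a \<in> p\<close>, the multiplicative set of all \<open>u a\<^sup>n\<close> with \<open>u \<notin> p\<close> contains 0, so in a
  reduced ring \<open>a\<close> vanishes in the localization at \<open>p\<close>, which is therefore a field.
\<close>

section \<open>Ideals avoiding a family of finite sets\<close>

text \<open>The family \<open>F\<close> stays a parameter so that one Zorn argument and one
  primality argument serve two cases: the singletons of a multiplicative set, and the finite dense
  sets.\<close>

definition avoids :: "'a set set \<Rightarrow> 'a set \<Rightarrow> bool"
  where "avoids F I \<longleftrightarrow> (\<forall>A\<in>F. \<not> A \<subseteq> I)"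

text \<open>Properness is not demanded: it follows as soon as \<open>F\<close> has a member inside
  the carrier.\<close>

definition maximal_avoiding :: "('a, 'r) ring_scheme \<Rightarrow> 'a set set \<Rightarrow> 'a set \<Rightarrow> bool"
  where "maximal_avoiding R F M \<longleftrightarrow>
    ideal M R \<and> avoids F M \<and> (\<forall>N. ideal N R \<and> avoids F N \<and> M \<subseteq> N \<longrightarrow> N = M)"

context cring
begin

text \<open>Zorn's lemma applies because a finite set inside the union of a nonempty chain already
  lies in one member of the chain; this is where finiteness of the sets in \<open>F\<close>
  enters.\<close>

lemma ex_maximal_avoiding:
  assumes I: "ideal I R" "avoids F I" and fin: "\<And>A. A \<in> F \<Longrightarrow> finite A"
  shows "\<exists>M. maximal_avoiding R F M \<and> I \<subseteq> M"
proof -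
  define \<A> where "\<A> = {J. ideal J R \<and> avoids F J \<and> I \<subseteq> J}"
  have "\<exists>M\<in>\<A>. \<forall>N\<in>\<A>. M \<subseteq> N \<longrightarrow> N = M"
  proof (rule subset_Zorn)
    fix C assume C: "subset.chain \<A> C"
    show "\<exists>U\<in>\<A>. \<forall>N\<in>C. N \<subseteq> U"
    proof (cases "C = {}")
      case True
      then show ?thesis using I by (auto simp: \<A>_def)
    next
      case False
      have "subset.chain {J. ideal J R} C"
        using C by (auto simp: subset_chain_def \<A>_def)
      then have "ideal (\<Union>C) R"
        using chain_Union_is_ideal False by presburger
      moreover have "avoids F (\<Union>C)"
        unfolding avoids_def
      proof (intro ballI notI)
        fix A assume A: "A \<in> F" "A \<subseteq> \<Union>C"
        then obtain B where "B \<in> C" "A \<subseteq> B"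
          using finite_subset_Union_chain[OF fin[OF A(1)] A(2) False C] by blast
        then show False
          using C A(1) unfolding subset_chain_def \<A>_def avoids_def by blast
      qed
      moreover have "I \<subseteq> \<Union>C"
        using C False unfolding subset_chain_def \<A>_def by blast
      ultimately show ?thesis by (auto simp: \<A>_def)
    qed
  qed
  then obtain M where "M \<in> \<A>" and "\<forall>N\<in>\<A>. M \<subseteq> N \<longrightarrow> N = M" by blast
  then have "maximal_avoiding R F M" "I \<subseteq> M"
    unfolding maximal_avoiding_def \<A>_def by auto
  then show ?thesis by blast
qed

text \<open>An element of M + (r) is m + yr, and x(m + yr) = xm + y(xr) has both terms in M.\<close>

lemma set_mult_sum_principal_subset:
  assumes "ideal M R" "r \<in> carrier R" "A \<subseteq> carrier R"
    and "\<And>x. x \<in> A \<Longrightarrow> x \<otimes> r \<in> M" and "K \<subseteq> set_add R M (PIdl r)"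
  shows "A <#> K \<subseteq> M"
proof
  interpret M: ideal M R by fact
  fix z assume "z \<in> A <#> K"
  then obtain x k where x: "x \<in> A" and "k \<in> K" and z: "z = x \<otimes> k"
    by (auto simp: set_mult_def)
  then have "k \<in> set_add R M (PIdl r)" using assms(5) by blast
  then obtain m y where m: "m \<in> M" and y: "y \<in> carrier R" and k: "k = m \<oplus> y \<otimes> r"
    unfolding set_add_def' cgenideal_def by blast
  have "x \<in> carrier R" "m \<in> carrier R"
    using x m assms(3) M.Icarr by auto
  then have "z = x \<otimes> m \<oplus> y \<otimes> (x \<otimes> r)"
    using y assms(2) by (simp add: z k r_distr m_lcomm)
  then show "z \<in> M"
    using assms(4)[OF x] m y \<open>x \<in> carrier R\<close> M.I_l_closed M.a_closed by simp
qed

text \<open>M + (r) is strictly larger than M, so by maximality it no longer avoids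
  \<open>F\<close>.\<close>

lemma maximal_avoiding_sum_principal:
  assumes "maximal_avoiding R F M" "r \<in> carrier R" "r \<notin> M"
  shows "\<exists>K\<in>F. K \<subseteq> set_add R M (PIdl r)"
proof -
  have M: "ideal M R" using assms(1) by (simp add: maximal_avoiding_def)
  interpret M: ideal M R by fact
  have id: "ideal (set_add R M (PIdl r)) R"
    using add_ideals M cgenideal_ideal assms(2) by blast
  have sub: "M \<union> PIdl r \<subseteq> set_add R M (PIdl r)"
    using union_genideal[OF M cgenideal_ideal[OF assms(2)]] genideal_self
    by (metis M Un_subset_iff assms(2) cgenideal_ideal ideal.Icarr subsetI)
  then have "r \<in> set_add R M (PIdl r)" using cgenideal_self[OF assms(2)] by blast
  then have "set_add R M (PIdl r) \<noteq> M" using assms(3) by blast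
  then show ?thesis
    using assms(1) id sub unfolding maximal_avoiding_def avoids_def by blast
qed

text \<open>If a and b both lie outside M, then M + (a) and M + (b) contain members A and B of
  \<open>F\<close>; from ab in M it follows that AB lies in M, although AB belongs to
  \<open>F\<close>.\<close>

lemma maximal_avoiding_prime:
  assumes M: "maximal_avoiding R F M" and "F \<noteq> {}"
    and F: "\<And>A. A \<in> F \<Longrightarrow> A \<subseteq> carrier R"
    and mult: "\<And>A B. A \<in> F \<Longrightarrow> B \<in> F \<Longrightarrow> A <#> B \<in> F"
  shows "primeideal M R"
proof (rule primeidealI)
  show id: "ideal M R" using M by (simp add: maximal_avoiding_def)
  show "cring R" by (rule is_cring)
  have av: "avoids F M" using M by (simp add: maximal_avoiding_def)
  then show "carrier R \<noteq> M"
    using F \<open>F \<noteq> {}\<close> by (auto simp: avoids_def)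
  fix a b assume a: "a \<in> carrier R" and b: "b \<in> carrier R" and ab: "a \<otimes> b \<in> M"
  show "a \<in> M \<or> b \<in> M"
  proof (rule ccontr)
    assume "\<not> (a \<in> M \<or> b \<in> M)"
    then obtain A B where A: "A \<in> F" "A \<subseteq> set_add R M (PIdl a)" and B: "B \<in> F" "B \<subseteq> set_add R M (PIdl b)"
      using maximal_avoiding_sum_principal[OF M] a b by meson
    \<comment> \<open>The product is absorbed in two rounds: ab in M gives bA inside M, and this in
      turn gives AB inside M.\<close>
    have "{b} <#> A \<subseteq> M"
      using a b ab m_comm by (intro set_mult_sum_principal_subset[OF id a _ _ A(2)]) auto
    then have "x \<otimes> b \<in> M" if "x \<in> A" for x
      using that F[OF A(1)] b m_comm by (fastforce simp: set_mult_def)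
    then have "A <#> B \<subseteq> M"
      using set_mult_sum_principal_subset[OF id b F[OF A(1)] _ B(2)] by blast
    then show False
      using mult[OF A(1) B(1)] av by (auto simp: avoids_def)
  qed
qed

text \<open>Krull's lemma: for the singletons of T, closure under set products is closure of T under
  multiplication, and the zero ideal is the ideal to enlarge.\<close>

lemma prime_avoiding_multiplicative_set:
  assumes "T \<subseteq> carrier R" "\<one> \<in> T" "\<And>x y. x \<in> T \<Longrightarrow> y \<in> T \<Longrightarrow> x \<otimes> y \<in> T" "\<zero> \<notin> T"
  shows "\<exists>P. primeideal P R \<and> P \<inter> T = {}"
proof -
  let ?F = "(\<lambda>t. {t}) ` T"
  have "avoids ?F {\<zero>}" using assms(4) by (auto simp: avoids_def)
  then obtain M where M: "maximal_avoiding R ?F M"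
    using ex_maximal_avoiding[OF zeroideal] by blast
  have "primeideal M R"
    using assms by (intro maximal_avoiding_prime[OF M]) (auto simp: set_mult_def)
  moreover have "M \<inter> T = {}"
    using M by (auto simp: maximal_avoiding_def avoids_def)
  ultimately show ?thesis by blast
qed

end


section \<open>Maximal q-ideals\<close>

text \<open>Generating sets stand in for finitely generated dense ideals. A set and the ideal it
  generates have the same annihilator, and products of ideals become products of finite
  sets.\<close>

definition finite_dense_sets :: "('a, 'r) ring_scheme \<Rightarrow> 'a set set"
  where "finite_dense_sets R = {A. finite A \<and> A \<subseteq> carrier R \<and> annihilator R A = {\<zero>\<^bsub>R\<^esub>}}"

context cring
begin

section \<open>Annihilators, finite dense sets and semi-regular ideals\<close>

lemma zero_in_annihilator: "A \<subseteq> carrier R \<Longrightarrow> \<zero> \<in> annihilator R A"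
  by (auto simp: annihilator_def)

lemma annihilator_ideal:
  assumes "A \<subseteq> carrier R"
  shows "ideal (annihilator R A) R"
proof (rule idealI)
  show "ring R" by (rule ring_axioms)
  show "subgroup (annihilator R A) (add_monoid R)"
  proof (rule add.subgroupI)
    show "annihilator R A \<noteq> {}" using zero_in_annihilator[OF assms] by blast
  qed (use assms in \<open>auto simp: annihilator_def l_distr l_minus subset_iff\<close>)
  show "x \<otimes> a \<in> annihilator R A" "a \<otimes> x \<in> annihilator R A"
    if "a \<in> annihilator R A" "x \<in> carrier R" for a x
    using that assms by (auto simp: annihilator_def m_assoc m_lcomm[of a x] subset_iff)
qed

text \<open>The elements killed by a fixed r form an ideal, so r kills the ideal generated by A once
  it kills A.\<close>

lemma annihilator_genideal:
  assumes "A \<subseteq> carrier R"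
  shows "annihilator R (Idl A) = annihilator R A"
proof
  show "annihilator R (Idl A) \<subseteq> annihilator R A"
    using genideal_self[OF assms] by (auto simp: annihilator_def)
  show "annihilator R A \<subseteq> annihilator R (Idl A)"
  proof
    fix r assume r: "r \<in> annihilator R A"
    then have rc: "r \<in> carrier R" by (simp add: annihilator_def)
    have "A \<subseteq> annihilator R {r}"
      using r rc assms by (auto simp: annihilator_def m_comm subset_iff)
    then have "Idl A \<subseteq> annihilator R {r}"
      using genideal_minimal annihilator_ideal rc by simp
    then show "r \<in> annihilator R (Idl A)"
      using rc by (auto simp: annihilator_def m_comm subset_iff)
  qed
qed

lemma finite_dense_set_finite: "A \<in> finite_dense_sets R \<Longrightarrow> finite A"
  by (simp add: finite_dense_sets_def)

lemma genideal_finite_dense: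
  assumes "A \<in> finite_dense_sets R"
  shows "Idl A \<in> fg_semi_regular_ideals R"
proof -
  have A: "finite A" "A \<subseteq> carrier R" "annihilator R A = {\<zero>}"
    using assms by (auto simp: finite_dense_sets_def)
  have "fg_ideal R (Idl A)" using A by (auto simp: fg_ideal_def)
  moreover have "dense_ideal R (Idl A)"
    using A genideal_ideal annihilator_genideal by (simp add: dense_ideal_def)
  ultimately show ?thesis
    unfolding fg_semi_regular_ideals_def semi_regular_ideal_def
    using A(2) genideal_ideal by blast
qed

lemma semi_regular_ideal_iff:
  "semi_regular_ideal R I \<longleftrightarrow> ideal I R \<and> \<not> avoids (finite_dense_sets R) I"
proof safe
  assume "semi_regular_ideal R I" 
  then show "ideal I R" by (simp add: semi_regular_ideal_def)
  assume av: "avoids (finite_dense_sets R) I"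
  obtain A where A: "finite A" "A \<subseteq> carrier R" "Idl A \<subseteq> I" "dense_ideal R (Idl A)"
    using \<open>semi_regular_ideal R I\<close> by (auto simp: semi_regular_ideal_def fg_ideal_def)
  then have "A \<in> finite_dense_sets R" "A \<subseteq> I"
    using annihilator_genideal genideal_self[OF A(2)]
    by (auto simp: finite_dense_sets_def dense_ideal_def)
  then show False using av by (auto simp: avoids_def)
next
  assume I: "ideal I R" "\<not> avoids (finite_dense_sets R) I"
  then obtain A where A: "A \<in> finite_dense_sets R" "A \<subseteq> I"
    by (auto simp: avoids_def)
  then have "Idl A \<subseteq> I" using genideal_minimal I by blast
  then show "semi_regular_ideal R I"
    using genideal_finite_dense[OF A(1)] I(1)
    unfolding fg_semi_regular_ideals_def semi_regular_ideal_def by blast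
qed

text \<open>If r kills AB, then each ra with a in A kills B and is 0; hence r kills A and is
  0.\<close>

lemma set_mult_finite_dense:
  assumes "A \<in> finite_dense_sets R" "B \<in> finite_dense_sets R"
  shows "A <#> B \<in> finite_dense_sets R"
proof -
  have A: "finite A" "A \<subseteq> carrier R" "annihilator R A = {\<zero>}"
    and B: "finite B" "B \<subseteq> carrier R" "annihilator R B = {\<zero>}"
    using assms by (auto simp: finite_dense_sets_def)
  have sub: "A <#> B \<subseteq> carrier R" using A B by (auto simp: set_mult_def)
  have "r = \<zero>" if r: "r \<in> annihilator R (A <#> B)" for r
  proof -
    have rc: "r \<in> carrier R" using r by (simp add: annihilator_def)
    have "r \<otimes> a = \<zero>" if "a \<in> A" for a
    proof -
      have "r \<otimes> a \<in> annihilator R B"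
        using r rc that A(2) B(2)
        by (fastforce simp: annihilator_def set_mult_def m_assoc subset_iff)
      then show ?thesis using B(3) by simp
    qed
    then have "r \<in> annihilator R A" using rc by (simp add: annihilator_def)
    then show ?thesis using A(3) by simp
  qed
  moreover have "finite (A <#> B)" using A(1) B(1) by (simp add: set_mult_def)
  ultimately show ?thesis
    using sub zero_in_annihilator by (auto simp: finite_dense_sets_def)
qed

lemma one_finite_dense: "{\<one>} \<in> finite_dense_sets R"
  by (auto simp: finite_dense_sets_def annihilator_def)

lemma maximal_avoiding_dense_prime:
  assumes "maximal_avoiding R (finite_dense_sets R) M"
  shows "primeideal M R"
proof (rule maximal_avoiding_prime[OF assms])
  show "finite_dense_sets R \<noteq> {}" using one_finite_dense by blast
qed (simp_all add: set_mult_finite_dense, simp add: finite_dense_sets_def)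

text \<open>Removes the envelope from the definition: as \<iota> is linear and injective, j times
  \<iota>(x) lies in the image of I exactly when jx lies in I.\<close>

lemma q_ideal_iff:
  assumes hom: "\<iota> \<in> module_hom R (regular_module R) E" and inj: "inj_on \<iota> (carrier R)"
  shows "q_ideal R E \<iota> I \<longleftrightarrow> ideal I R \<and>
    (\<forall>x\<in>carrier R. (\<exists>J\<in>fg_semi_regular_ideals R. \<forall>j\<in>J. j \<otimes> x \<in> I) \<longrightarrow> x \<in> I)"
proof (cases "ideal I R")
  case True
  interpret I: ideal I R by fact
  have \<iota>c: "\<iota> x \<in> carrier E" if "x \<in> carrier R" for x
    using hom that by (auto simp: module_hom_def regular_module_def)
  have mem: "\<iota> x \<in> \<iota> ` I \<longleftrightarrow> x \<in> I" if "x \<in> carrier R" for x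
    using inj_on_image_mem_iff[OF inj that] I.Icarr by blast
  have sm: "r \<odot>\<^bsub>E\<^esub> \<iota> x = \<iota> (r \<otimes> x)" if "r \<in> carrier R" "x \<in> carrier R" for r x
    using hom that by (simp add: module_hom_def regular_module_def)
  have J: "J \<subseteq> carrier R" if "J \<in> fg_semi_regular_ideals R" for J
    using that by (auto simp: fg_semi_regular_ideals_def semi_regular_ideal_def
        dest: ideal.Icarr)
  have cl: "\<iota> x \<in> q_closure R E \<iota> I \<longleftrightarrow> (\<exists>J\<in>fg_semi_regular_ideals R. \<forall>j\<in>J. j \<otimes> x \<in> I)"
    if x: "x \<in> carrier R" for x
  proof -
    have "j \<odot>\<^bsub>E\<^esub> \<iota> x \<in> \<iota> ` I \<longleftrightarrow> j \<otimes> x \<in> I"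
      if "J \<in> fg_semi_regular_ideals R" "j \<in> J" for J j
    proof -
      have "j \<in> carrier R" using J that by blast
      then show ?thesis using sm mem x by simp
    qed
    then show ?thesis
      unfolding q_closure_def using \<iota>c[OF x] by auto
  qed
  have "\<iota> ` I \<subseteq> q_closure R E \<iota> I \<inter> \<iota> ` carrier R"
  proof
    fix y assume "y \<in> \<iota> ` I"
    then obtain x where x: "x \<in> I" "y = \<iota> x" by blast
    \<comment> \<open>The unit ideal is the witness showing that the image of I always lies in its
      q-closure, so only the reverse inclusion is a condition on I.\<close>
    have 1: "Idl {\<one>} \<in> fg_semi_regular_ideals R"
      using genideal_finite_dense one_finite_dense by blast
    then have "\<forall>j\<in>Idl {\<one>}. j \<otimes> x \<in> I"
      using J[OF 1] I.I_l_closed[OF x(1)] by auto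
    then have "y \<in> q_closure R E \<iota> I"
      unfolding x(2) cl[OF I.Icarr[OF x(1)]] using 1 by blast
    then show "y \<in> q_closure R E \<iota> I \<inter> \<iota> ` carrier R"
      using x I.Icarr by blast
  qed
  then have "q_closure R E \<iota> I \<inter> \<iota> ` carrier R = \<iota> ` I \<longleftrightarrow>
      (\<forall>x\<in>carrier R. \<iota> x \<in> q_closure R E \<iota> I \<longrightarrow> x \<in> I)"
    using mem by blast
  then show ?thesis
    using True cl by (auto simp: q_ideal_def)
qed (simp add: q_ideal_def)

text \<open>A finite dense set inside I generates an ideal that multiplies 1 into I, so a q-ideal
  containing one contains 1.\<close>

lemma proper_q_ideal_avoids:
  assumes "\<iota> \<in> module_hom R (regular_module R) E" "inj_on \<iota> (carrier R)"
    and q: "q_ideal R E \<iota> I" and "I \<noteq> carrier R"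
  shows "avoids (finite_dense_sets R) I"
proof (rule ccontr)
  assume "\<not> ?thesis"
  then obtain A where A: "A \<in> finite_dense_sets R" "A \<subseteq> I"
    by (auto simp: avoids_def)
  have I: "ideal I R" using q by (simp add: q_ideal_def)
  interpret I: ideal I R by fact
  have "Idl A \<subseteq> I" using genideal_minimal[OF I A(2)] .
  then have "\<forall>j\<in>Idl A. j \<otimes> \<one> \<in> I"
    using I.Icarr by auto
  then have "\<one> \<in> I"
    using q genideal_finite_dense[OF A(1)] unfolding q_ideal_iff[OF assms(1,2)] by blast
  then show False using I.one_imp_carrier assms(4) by blast
qed

text \<open>Let A be finite dense with Ax inside M. If x were outside M, then M + (x) would contain
  a finite dense K, and the finite dense set AK would lie in M.\<close>

lemma maximal_avoiding_q_ideal: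
  assumes "\<iota> \<in> module_hom R (regular_module R) E" "inj_on \<iota> (carrier R)"
    and M: "maximal_avoiding R (finite_dense_sets R) M"
  shows "q_ideal R E \<iota> M"
  unfolding q_ideal_iff[OF assms(1,2)]
proof (intro conjI ballI impI)
  show id: "ideal M R" using M by (simp add: maximal_avoiding_def)
  fix x assume x: "x \<in> carrier R"
    and "\<exists>J\<in>fg_semi_regular_ideals R. \<forall>j\<in>J. j \<otimes> x \<in> M"
  then obtain A where A: "A \<in> finite_dense_sets R" "\<forall>j\<in>A. j \<otimes> x \<in> M"
    unfolding fg_semi_regular_ideals_def semi_regular_ideal_iff avoids_def by blast
  show "x \<in> M"
  proof (rule ccontr)
    assume "x \<notin> M"
    then obtain K where K: "K \<in> finite_dense_sets R" "K \<subseteq> set_add R M (PIdl x)"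
      using maximal_avoiding_sum_principal[OF M x] by blast
    have "A <#> K \<subseteq> M"
      using A by (intro set_mult_sum_principal_subset[OF id x _ _ K(2)])
        (auto simp: finite_dense_sets_def)
    then show False
      using set_mult_finite_dense[OF A(1) K(1)] M
      by (auto simp: maximal_avoiding_def avoids_def)
  qed
qed

text \<open>Every proper q-ideal avoids the finite dense sets, so it extends to a maximal avoiding
  ideal, which is again a proper q-ideal. Hence the two notions of maximality agree.\<close>

lemma q_Max_eq:
  assumes "\<iota> \<in> module_hom R (regular_module R) E" "inj_on \<iota> (carrier R)"
  shows "q_Max R E \<iota> = {M. maximal_avoiding R (finite_dense_sets R) M}"
proof safe
  note proper = maximal_avoiding_dense_prime[THEN primeideal.I_notcarr, symmetric]
  fix M
  {
    assume M: "M \<in> q_Max R E \<iota>"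
    then have "ideal M R" "avoids (finite_dense_sets R) M"
      using proper_q_ideal_avoids[OF assms] by (auto simp: q_Max_def q_ideal_def)
    then obtain N where N: "maximal_avoiding R (finite_dense_sets R) N" "M \<subseteq> N"
      using ex_maximal_avoiding[of M "finite_dense_sets R"] finite_dense_set_finite by meson
    then have "N = M"
      using M maximal_avoiding_q_ideal[OF assms] proper by (auto simp: q_Max_def)
    then show "maximal_avoiding R (finite_dense_sets R) M" using N by simp
  }
  assume M: "maximal_avoiding R (finite_dense_sets R) M"
  then show "M \<in> q_Max R E \<iota>"
    using maximal_avoiding_q_ideal[OF assms M] proper[OF M] proper_q_ideal_avoids[OF assms]
    by (auto simp: q_Max_def maximal_avoiding_def q_ideal_def)
qed

text \<open>A finite dense set inside the annihilator of x would itself be annihilated by x, forcing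
  x = 0.\<close>

lemma annihilator_subset_maximal_avoiding:
  assumes x: "x \<in> carrier R" "x \<noteq> \<zero>"
  shows "\<exists>M. maximal_avoiding R (finite_dense_sets R) M \<and> annihilator R {x} \<subseteq> M"
proof (rule ex_maximal_avoiding)
  show "ideal (annihilator R {x}) R" using x by (simp add: annihilator_ideal)
  show "avoids (finite_dense_sets R) (annihilator R {x})"
    unfolding avoids_def
  proof (intro ballI notI)
    fix A assume A: "A \<in> finite_dense_sets R" "A \<subseteq> annihilator R {x}"
    then have "x \<in> annihilator R A"
      using x(1) by (auto simp: annihilator_def m_comm subset_iff)
    then show False using A x(2) by (simp add: finite_dense_sets_def)
  qed
qed (simp add: finite_dense_sets_def)

end


section \<open>Localization\<close>

text \<open>Evaluates the unions that define the operations on fractions, reducing well-definedness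
  to independence of the representatives.\<close>

lemma UN_pair_constant:
  assumes "V \<noteq> {}" "W \<noteq> {}"
    and "\<And>a s b t. (a, s) \<in> V \<Longrightarrow> (b, t) \<in> W \<Longrightarrow> g a s b t = C"
  shows "(\<Union>(a, s)\<in>V. \<Union>(b, t)\<in>W. g a s b t) = C"
proof -
  have "(case v of (a, s) \<Rightarrow> \<Union>(b, t)\<in>W. g a s b t) = C" if "v \<in> V" for v
  proof (cases v)
    case (Pair a s)
    then have "(\<Union>(b, t)\<in>W. g a s b t) = (\<Union>w\<in>W. C)"
      using assms(3)[of a s] that by (intro SUP_cong) auto
    then show ?thesis using Pair assms(2) by simp
  qed
  then have "(\<Union>(a, s)\<in>V. \<Union>(b, t)\<in>W. g a s b t) = (\<Union>v\<in>V. C)"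
    by (intro SUP_cong) auto
  then show ?thesis using assms(1) by simp
qed

locale multiplicative_subset = cring R for R (structure) +
  fixes S :: "'a set"
  assumes S_subset: "S \<subseteq> carrier R"
    and one_in_S: "\<one> \<in> S"
    and S_mult: "\<And>s t. s \<in> S \<Longrightarrow> t \<in> S \<Longrightarrow> s \<otimes> t \<in> S"
begin

section \<open>Equality of fractions\<close>

lemma S_carrier: "s \<in> S \<Longrightarrow> s \<in> carrier R"
  using S_subset by blast

text \<open>The subtraction is traded for an equation between products, so that most later
  computations only rearrange factors.\<close>

lemma fraction_rel_iff:
  "((a, s), (b, t)) \<in> fraction_rel R S \<longleftrightarrow>
    a \<in> carrier R \<and> s \<in> S \<and> b \<in> carrier R \<and> t \<in> S \<and> (\<exists>u\<in>S. u \<otimes> (a \<otimes> t) = u \<otimes> (b \<otimes> s))"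
proof -
  have "u \<otimes> (a \<otimes> t \<ominus> b \<otimes> s) = \<zero> \<longleftrightarrow> u \<otimes> (a \<otimes> t) = u \<otimes> (b \<otimes> s)"
    if "u \<in> S" "a \<in> carrier R" "s \<in> S" "b \<in> carrier R" "t \<in> S" for u
  proof -
    have c: "u \<in> carrier R" "s \<in> carrier R" "t \<in> carrier R" using that S_carrier by auto
    have "u \<otimes> (a \<otimes> t \<ominus> b \<otimes> s) = u \<otimes> (a \<otimes> t) \<ominus> u \<otimes> (b \<otimes> s)"
      using c that by (simp add: minus_eq r_distr r_minus)
    then show ?thesis using c that by (metis r_right_minus_eq m_closed)
  qed
  then show ?thesis unfolding fraction_rel_def by auto
qed

lemma equiv_fraction_rel: "equiv (carrier R \<times> S) (fraction_rel R S)"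
proof (rule equivI)
  show "fraction_rel R S \<subseteq> (carrier R \<times> S) \<times> (carrier R \<times> S)"
    by (auto simp: fraction_rel_def)
  show "refl_on (carrier R \<times> S) (fraction_rel R S)"
    unfolding refl_on_def using one_in_S by (auto simp: fraction_rel_iff)
  show "sym (fraction_rel R S)"
    by (rule symI) (clarsimp simp: fraction_rel_iff, metis)
  show "trans (fraction_rel R S)"
  proof (rule transI, clarsimp simp: fraction_rel_iff)
    fix a s b t c r u v
    assume c: "a \<in> carrier R" "b \<in> carrier R" "c \<in> carrier R"
      and S: "s \<in> S" "t \<in> S" "r \<in> S" "u \<in> S" "v \<in> S"
      and 1: "u \<otimes> (a \<otimes> t) = u \<otimes> (b \<otimes> s)" and 2: "v \<otimes> (b \<otimes> r) = v \<otimes> (c \<otimes> t)"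
    note sc = S[THEN S_carrier]
    \<comment> \<open>Besides both witnesses u and v, the new witness needs the middle denominator
      t, which both given equations involve.\<close>
    have "u \<otimes> v \<otimes> t \<otimes> (a \<otimes> r) = u \<otimes> (a \<otimes> t) \<otimes> (v \<otimes> r)"
      using c sc by (simp add: m_ac)
    also have "\<dots> = v \<otimes> (b \<otimes> r) \<otimes> (u \<otimes> s)"
      unfolding 1 using c sc by (simp add: m_ac)
    also have "\<dots> = u \<otimes> v \<otimes> t \<otimes> (c \<otimes> s)"
      unfolding 2 using c sc by (simp add: m_ac)
    finally show "\<exists>w\<in>S. w \<otimes> (a \<otimes> r) = w \<otimes> (c \<otimes> s)"
      using S S_mult by blast
  qed
qed

lemma fraction_eq_iff:
  assumes "a \<in> carrier R" "s \<in> S" "b \<in> carrier R" "t \<in> S"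
  shows "fraction R S a s = fraction R S b t \<longleftrightarrow> (\<exists>u\<in>S. u \<otimes> (a \<otimes> t) = u \<otimes> (b \<otimes> s))"
  unfolding fraction_def
  using eq_equiv_class_iff[OF equiv_fraction_rel] assms by (simp add: fraction_rel_iff)

lemma fraction_eqI:
  assumes "a \<in> carrier R" "s \<in> S" "b \<in> carrier R" "t \<in> S" "a \<otimes> t = b \<otimes> s"
  shows "fraction R S a s = fraction R S b t"
  using assms one_in_S by (auto simp: fraction_eq_iff)

lemma mem_fraction_iff: "(b, t) \<in> fraction R S a s \<longleftrightarrow> ((a, s), (b, t)) \<in> fraction_rel R S"
  by (simp add: fraction_def)

lemma fraction_nonempty: "a \<in> carrier R \<Longrightarrow> s \<in> S \<Longrightarrow> fraction R S a s \<noteq> {}"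
  using equiv_class_self[OF equiv_fraction_rel] by (fastforce simp: fraction_def)

section \<open>The ring structure on fractions\<close>

lemma fraction_closed:
  "a \<in> carrier R \<Longrightarrow> s \<in> S \<Longrightarrow> fraction R S a s \<in> carrier (localization R S)"
  by (auto simp: localization_def fraction_def intro: quotientI)

lemma localization_cases:
  assumes "x \<in> carrier (localization R S)"
  obtains a s where "a \<in> carrier R" "s \<in> S" "x = fraction R S a s"
  using assms by (auto simp: localization_def fraction_def elim!: quotientE)

text \<open>If u and v witness the equivalence of the two pairs of representatives, then uv
  witnesses it for the products.\<close>

lemma localization_mult:
  assumes "a \<in> carrier R" "s \<in> S" "b \<in> carrier R" "t \<in> S"
  shows "fraction R S a s \<otimes>\<^bsub>localization R S\<^esub> fraction R S b t = fraction R S (a \<otimes> b) (s \<otimes> t)"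
proof -
  have "fraction R S (a' \<otimes> b') (s' \<otimes> t') = fraction R S (a \<otimes> b) (s \<otimes> t)"
    if eqv: "(a', s') \<in> fraction R S a s" "(b', t') \<in> fraction R S b t"
    for a' s' b' t'
  proof -
    obtain u v where uv: "u \<in> S" "v \<in> S" "u \<otimes> (a \<otimes> s') = u \<otimes> (a' \<otimes> s)" "v \<otimes> (b \<otimes> t') = v \<otimes> (b' \<otimes> t)"
      and c: "a' \<in> carrier R" "b' \<in> carrier R" and S: "s' \<in> S" "t' \<in> S"
      using eqv unfolding mem_fraction_iff fraction_rel_iff by blast
    note sc = uv(1,2)[THEN S_carrier] S[THEN S_carrier] assms(2,4)[THEN S_carrier]
    have "u \<otimes> v \<otimes> (a' \<otimes> b' \<otimes> (s \<otimes> t)) = u \<otimes> (a' \<otimes> s) \<otimes> (v \<otimes> (b' \<otimes> t))"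
      using sc c by (simp add: m_ac)
    also have "\<dots> = u \<otimes> v \<otimes> (a \<otimes> b \<otimes> (s' \<otimes> t'))"
      unfolding uv(3,4)[symmetric] using sc assms by (simp add: m_ac)
    finally show ?thesis
      using uv(1,2) c S assms S_mult by (subst fraction_eq_iff) auto
  qed
  then show ?thesis
    unfolding localization_def
    by (simp, intro UN_pair_constant fraction_nonempty assms)
qed

text \<open>The witness uv works again: each summand uses one of the two given equations.\<close>

lemma localization_add:
  assumes "a \<in> carrier R" "s \<in> S" "b \<in> carrier R" "t \<in> S"
  shows "fraction R S a s \<oplus>\<^bsub>localization R S\<^esub> fraction R S b t =
    fraction R S (a \<otimes> t \<oplus> b \<otimes> s) (s \<otimes> t)"
proof -
  have "fraction R S (a' \<otimes> t' \<oplus> b' \<otimes> s') (s' \<otimes> t') = fraction R S (a \<otimes> t \<oplus> b \<otimes> s) (s \<otimes> t)"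
    if eqv: "(a', s') \<in> fraction R S a s" "(b', t') \<in> fraction R S b t"
    for a' s' b' t'
  proof -
    obtain u v where uv: "u \<in> S" "v \<in> S" "u \<otimes> (a \<otimes> s') = u \<otimes> (a' \<otimes> s)" "v \<otimes> (b \<otimes> t') = v \<otimes> (b' \<otimes> t)"
      and c: "a' \<in> carrier R" "b' \<in> carrier R" and S: "s' \<in> S" "t' \<in> S"
      using eqv unfolding mem_fraction_iff fraction_rel_iff by blast
    note sc = uv(1,2)[THEN S_carrier] S[THEN S_carrier] assms(2,4)[THEN S_carrier]
    have "u \<otimes> v \<otimes> ((a' \<otimes> t' \<oplus> b' \<otimes> s') \<otimes> (s \<otimes> t)) =
        u \<otimes> (a' \<otimes> s) \<otimes> (v \<otimes> t \<otimes> t') \<oplus> v \<otimes> (b' \<otimes> t) \<otimes> (u \<otimes> s \<otimes> s')"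
      using sc c by (simp add: m_ac l_distr r_distr)
    also have "\<dots> = u \<otimes> v \<otimes> ((a \<otimes> t \<oplus> b \<otimes> s) \<otimes> (s' \<otimes> t'))"
      unfolding uv(3,4)[symmetric] using sc assms by (simp add: m_ac l_distr r_distr)
    finally show ?thesis
      using uv(1,2) c S assms S_mult S_carrier by (subst fraction_eq_iff) auto
  qed
  then show ?thesis
    unfolding localization_def
    by (simp, intro UN_pair_constant fraction_nonempty assms)
qed

lemma localization_zero: "\<zero>\<^bsub>localization R S\<^esub> = fraction R S \<zero> \<one>"
  and localization_one: "\<one>\<^bsub>localization R S\<^esub> = fraction R S \<one> \<one>"
  by (simp_all add: localization_def)

text \<open>Each axiom becomes an equality of explicit fractions that already holds after
  cross-multiplication, with witness 1.\<close>

lemma cring_localization: "cring (localization R S)"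
proof (rule cringI)
  note simps = localization_mult localization_add localization_zero localization_one
    fraction_closed one_in_S S_mult S_carrier
  show "abelian_group (localization R S)"
  proof (rule abelian_groupI)
    fix x assume "x \<in> carrier (localization R S)"
    then obtain a s where a: "a \<in> carrier R" and s: "s \<in> S" and x: "x = fraction R S a s"
      by (elim localization_cases)
    have "fraction R S (\<ominus> a) s \<oplus>\<^bsub>localization R S\<^esub> x = \<zero>\<^bsub>localization R S\<^esub>"
      using a s unfolding x
      by (simp add: simps, intro fraction_eqI) (auto simp: simps l_minus l_neg)
    then show "\<exists>y\<in>carrier (localization R S). y \<oplus>\<^bsub>localization R S\<^esub> x = \<zero>\<^bsub>localization R S\<^esub>"
      using a s fraction_closed by blast
  qed (auto simp: simps m_ac l_distr r_distr a_ac elim!: localization_cases intro!: fraction_eqI)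
  show "comm_monoid (localization R S)"
    by (rule comm_monoidI; (elim localization_cases)?; hypsubst?)
      (auto simp: simps m_ac intro!: fraction_eqI)
  fix x y z
  assume "x \<in> carrier (localization R S)" "y \<in> carrier (localization R S)"
    "z \<in> carrier (localization R S)"
  then show "(x \<oplus>\<^bsub>localization R S\<^esub> y) \<otimes>\<^bsub>localization R S\<^esub> z =
      x \<otimes>\<^bsub>localization R S\<^esub> z \<oplus>\<^bsub>localization R S\<^esub> y \<otimes>\<^bsub>localization R S\<^esub> z"
    by (elim localization_cases, simp add: simps, intro fraction_eqI)
      (auto simp: simps m_ac l_distr r_distr)
qed

text \<open>Clearing denominators in a/1 = (a/1)(x/s)(a/1) gives an equation in R, with a factor
  from S on the left. Conversely, ta = x(aa) makes (sx)/t a quasi-inverse of a/s.\<close>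

lemma von_neumann_regular_localization_iff:
  "von_neumann_regular (localization R S) \<longleftrightarrow>
    (\<forall>a\<in>carrier R. \<exists>x\<in>carrier R. \<exists>t\<in>S. t \<otimes> a = x \<otimes> (a \<otimes> a))"
proof
  assume vnr: "von_neumann_regular (localization R S)"
  show "\<forall>a\<in>carrier R. \<exists>x\<in>carrier R. \<exists>t\<in>S. t \<otimes> a = x \<otimes> (a \<otimes> a)"
  proof
    fix a assume a: "a \<in> carrier R"
    then obtain y where "y \<in> carrier (localization R S)"
      and y: "fraction R S a \<one> = fraction R S a \<one> \<otimes>\<^bsub>localization R S\<^esub> y
        \<otimes>\<^bsub>localization R S\<^esub> fraction R S a \<one>"
      using vnr fraction_closed one_in_S unfolding von_neumann_regular_def by blast
    then obtain x s where x: "x \<in> carrier R" and s: "s \<in> S" and "y = fraction R S x s"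
      by (elim localization_cases)
    with y have "fraction R S a \<one> = fraction R S (a \<otimes> x \<otimes> a) s"
      using a one_in_S by (simp add: localization_mult S_carrier)
    then obtain u where u: "u \<in> S" "u \<otimes> (a \<otimes> s) = u \<otimes> (a \<otimes> x \<otimes> a)"
      using a x s one_in_S by (auto simp: fraction_eq_iff)
    then have "u \<otimes> s \<otimes> a = u \<otimes> x \<otimes> (a \<otimes> a)"
      using a x s S_carrier by (simp add: m_ac)
    then show "\<exists>x\<in>carrier R. \<exists>t\<in>S. t \<otimes> a = x \<otimes> (a \<otimes> a)"
      using u x s S_mult S_carrier by blast
  qed
next
  assume *: "\<forall>a\<in>carrier R. \<exists>x\<in>carrier R. \<exists>t\<in>S. t \<otimes> a = x \<otimes> (a \<otimes> a)"
  show "von_neumann_regular (localization R S)"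
    unfolding von_neumann_regular_def
  proof (intro conjI ballI)
    show "cring (localization R S)" by (rule cring_localization)
    fix y assume "y \<in> carrier (localization R S)"
    then obtain a s where a: "a \<in> carrier R" and s: "s \<in> S" and y: "y = fraction R S a s"
      by (elim localization_cases)
    obtain x t where x: "x \<in> carrier R" and t: "t \<in> S" and eq: "t \<otimes> a = x \<otimes> (a \<otimes> a)"
      using * a by blast
    note sc = s[THEN S_carrier] t[THEN S_carrier]
    \<comment> \<open>This is the cross-multiplied form of a/s = (a/s)((sx)/t)(a/s); the factor s in
      sx makes up for the second denominator s.\<close>
    have "a \<otimes> (s \<otimes> t \<otimes> s) = t \<otimes> a \<otimes> (s \<otimes> s)"
      using a sc by (simp add: m_ac)
    also have "\<dots> = a \<otimes> (s \<otimes> x) \<otimes> a \<otimes> s"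
      unfolding eq using a x sc by (simp add: m_ac)
    finally have "fraction R S a s = fraction R S (a \<otimes> (s \<otimes> x) \<otimes> a) (s \<otimes> t \<otimes> s)"
      using a x s t sc S_mult by (intro fraction_eqI) simp_all
    then have "y = y \<otimes>\<^bsub>localization R S\<^esub> fraction R S (s \<otimes> x) t \<otimes>\<^bsub>localization R S\<^esub> y"
      unfolding y localization_mult[OF a s m_closed[OF sc(1) x] t]
      using a x s t sc S_mult by (subst localization_mult) auto
    then show "\<exists>z\<in>carrier (localization R S).
        y = y \<otimes>\<^bsub>localization R S\<^esub> z \<otimes>\<^bsub>localization R S\<^esub> y"
      using x t sc fraction_closed by blast
  qed
qed

end

lemma (in primeideal) multiplicative_subset_complement: "multiplicative_subset R (carrier R - I)"
  by unfold_locales (use I_prime I_notcarr one_imp_carrier in auto)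


section \<open>Regularity at a prime and height zero\<close>

lemma Sup_enat_eq_zero_iff: "Sup A = (0 :: enat) \<longleftrightarrow> (\<forall>x\<in>A. x = 0)"
proof
  show "\<forall>x\<in>A. x = 0" if "Sup A = 0"
    using Sup_upper[of _ A] that by auto
  show "Sup A = 0" if "\<forall>x\<in>A. x = 0"
    using Sup_least[of A 0] that by auto
qed

context cring
begin

text \<open>Height 0 means that no chain of primes ending in p has a proper inclusion. If p is not
  prime there are no chains at all and the supremum is 0, hence the primality of p under the
  negation.\<close>

lemma height_eq_zero_iff:
  "height R p = 0 \<longleftrightarrow> \<not> (primeideal p R \<and> (\<exists>p'. primeideal p' R \<and> p' \<subset> p))"
proof -
  have "height R p = 0 \<longleftrightarrow> (\<forall>n P. (\<forall>i\<le>n. primeideal (P i) R) \<and> (\<forall>i<n. P i \<subset> P (Suc i)) \<and> P n = p \<longrightarrow> n = 0)"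
    unfolding height_def Sup_enat_eq_zero_iff by (auto simp: zero_enat_def)
  also have "\<dots> \<longleftrightarrow> \<not> (primeideal p R \<and> (\<exists>p'. primeideal p' R \<and> p' \<subset> p))" (is "?A \<longleftrightarrow> ?B")
  proof
    assume A: ?A
    show ?B
    proof
      assume "primeideal p R \<and> (\<exists>p'. primeideal p' R \<and> p' \<subset> p)"
      then obtain p' where p': "primeideal p R" "primeideal p' R" "p' \<subset> p" by blast
      define P where "P i = (if i = 0 then p' else p)" for i :: nat
      have "(\<forall>i\<le>1. primeideal (P i) R) \<and> (\<forall>i<1. P i \<subset> P (Suc i)) \<and> P 1 = p"
        using p' by (simp add: P_def)
      then have "(1::nat) = 0"
        by (rule A[rule_format])
      then show False by simp
    qed
  next
    assume B: ?B
    show ?A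
    proof (intro allI impI)
      fix n P
      assume P: "(\<forall>i\<le>n. primeideal (P i) R) \<and> (\<forall>i<n. P i \<subset> P (Suc i)) \<and> P n = p"
      show "n = 0"
      proof (rule ccontr)
        assume "n \<noteq> 0"
        \<comment> \<open>The last inclusion of the chain, from \<open>P k\<close> to
          \<open>P n\<close>, exhibits a smaller prime.\<close>
        then obtain k where "n = Suc k" by (auto simp: gr0_conv_Suc)
        then show False using P B by (metis le_Suc_eq lessI order_refl)
      qed
    qed
  qed
  finally show ?thesis .
qed

text \<open>Choose a in p but not in p', and t outside p with ta = x(aa). Then (t - xa)a = 0 puts t
  - xa into p', hence into p, and xa in p forces t into p.\<close>

lemma von_neumann_regular_at_prime_minimal:
  assumes p: "primeideal p R" and vnr: "von_neumann_regular (localization_at R p)"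
    and p': "primeideal p' R"
  shows "\<not> p' \<subset> p"
proof
  assume sub: "p' \<subset> p"
  interpret p: primeideal p R by fact
  interpret p': primeideal p' R by fact
  interpret S: multiplicative_subset R "carrier R - p"
    by (rule p.multiplicative_subset_complement)
  obtain a where a: "a \<in> p" "a \<notin> p'" using sub by blast
  then have ac: "a \<in> carrier R" using p.Icarr by blast
  then obtain x t where x: "x \<in> carrier R" and t: "t \<in> carrier R" "t \<notin> p"
    and eq: "t \<otimes> a = x \<otimes> (a \<otimes> a)"
    using vnr S.von_neumann_regular_localization_iff unfolding localization_at_def by blast
  have "(t \<ominus> x \<otimes> a) \<otimes> a = \<zero>"
    using eq ac x t by (simp add: minus_eq l_distr l_minus m_assoc r_neg)
  then have "t \<ominus> x \<otimes> a \<in> p'"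
    using p'.I_prime[of "t \<ominus> x \<otimes> a" a] a ac x t by auto
  then have "(t \<ominus> x \<otimes> a) \<oplus> x \<otimes> a \<in> p"
    using sub a x p.I_l_closed p.a_closed by blast
  then show False
    using t ac x by (simp add: minus_eq a_assoc l_neg)
qed

text \<open>A regular ring has no nonzero nilpotents; in terms of R, iterating ty = x(yy) pushes
  powers of y into the right-hand side until it vanishes, while powers of t stay outside p.\<close>

lemma von_neumann_regular_at_prime_nilpotent:
  assumes p: "primeideal p R" and vnr: "von_neumann_regular (localization_at R p)"
    and y: "y \<in> carrier R" "y [^] (n::nat) = \<zero>"
  shows "\<exists>u\<in>carrier R - p. u \<otimes> y = \<zero>"
proof -
  interpret p: primeideal p R by fact
  interpret S: multiplicative_subset R "carrier R - p"
    by (rule p.multiplicative_subset_complement)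
  obtain x t where x: "x \<in> carrier R" and t: "t \<in> carrier R - p"
    and eq: "t \<otimes> y = x \<otimes> (y \<otimes> y)"
    using y(1) vnr S.von_neumann_regular_localization_iff unfolding localization_at_def by blast
  have tc: "t \<in> carrier R" using t by blast
  have "t [^] k \<otimes> y = x [^] k \<otimes> y [^] k \<otimes> y" for k :: nat
  proof (induction k)
    case 0
    show ?case using y by simp
  next
    case (Suc k)
    have "t [^] Suc k \<otimes> y = t \<otimes> (t [^] k \<otimes> y)"
      using tc y(1) by (simp add: m_ac)
    also have "\<dots> = x [^] k \<otimes> y [^] k \<otimes> (t \<otimes> y)"
      unfolding Suc using tc x y(1) by (simp add: m_ac)
    also have "\<dots> = x [^] Suc k \<otimes> y [^] Suc k \<otimes> y"
      unfolding eq using x y(1) by (simp add: m_ac)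
    finally show ?case .
  qed
  then have "t [^] n \<otimes> y = \<zero>" using x y by simp
  moreover have "t [^] k \<in> carrier R - p" for k :: nat
    by (induction k) (use t S.one_in_S S.S_mult in simp_all)
  ultimately show ?thesis by blast
qed

lemma von_neumann_regular_at_minimal_prime:
  assumes red: "reduced_ring R" and p: "primeideal p R"
    and min: "\<And>p'. primeideal p' R \<Longrightarrow> \<not> p' \<subset> p"
  shows "von_neumann_regular (localization_at R p)"
proof -
  interpret p: primeideal p R by fact
  interpret S: multiplicative_subset R "carrier R - p"
    by (rule p.multiplicative_subset_complement)
  have "\<exists>x\<in>carrier R. \<exists>t\<in>carrier R - p. t \<otimes> a = x \<otimes> (a \<otimes> a)" if a: "a \<in> carrier R" for a
  proof (cases "a \<in> p")
    case False
    \<comment> \<open>Outside p the element a is itself an admissible denominator: take t = a and x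
      = 1.\<close>
    then show ?thesis using a by (intro bexI[of _ \<one>] bexI[of _ a]) auto
  next
    case True
    \<comment> \<open>This is the multiplicative set generated by a and the complement of p. A prime
      disjoint from it lies in p and omits a, against minimality of p.\<close>
    define T where "T = {u \<otimes> a [^] n | u n. u \<in> carrier R - p \<and> n \<in> (UNIV :: nat set)}"
    have T: "u \<otimes> a [^] n \<in> T" if "u \<in> carrier R - p" for u and n :: nat
      using that by (auto simp: T_def)
    have compl: "carrier R - p \<subseteq> T"
      using T[of _ 0] by fastforce
    have T_sub: "T \<subseteq> carrier R" using a by (auto simp: T_def)
    have T_mult: "x \<otimes> y \<in> T" if xy: "x \<in> T" "y \<in> T" for x y
    proof -
      obtain u v and m n :: nat where
        "x = u \<otimes> a [^] m" "y = v \<otimes> a [^] n" "u \<in> carrier R - p" "v \<in> carrier R - p"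
        using xy unfolding T_def by blast
      moreover from this have "x \<otimes> y = (u \<otimes> v) \<otimes> a [^] (m + n)"
        using a by (simp add: nat_pow_mult[symmetric] m_ac)
      ultimately show ?thesis using T S.S_mult by simp
    qed
    have "\<zero> \<in> T"
    proof (rule ccontr)
      assume zero: "\<zero> \<notin> T"
      have "\<one> \<in> T" using compl S.one_in_S by blast
      then obtain P where P: "primeideal P R" "P \<inter> T = {}"
        using prime_avoiding_multiplicative_set[OF T_sub _ T_mult zero] by blast
      then have "P \<subseteq> p"
        using compl ideal.Icarr[OF primeideal.axioms(1)[OF P(1)]] by blast
      moreover have "a \<in> T" using T[OF S.one_in_S, of 1] a by simp
      ultimately show False using P True min by blast
    qed
    then obtain u and n :: nat where u: "u \<in> carrier R - p" "u \<otimes> a [^] n = \<zero>"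
      by (auto simp: T_def)
    \<comment> \<open>The exponent n + 1 leaves a full factor u a^n for every n, including n =
      0.\<close>
    have "(u \<otimes> a) [^] Suc n = u [^] n \<otimes> a \<otimes> (u \<otimes> a [^] n)"
      using u(1) a by (simp add: nat_pow_distrib m_ac)
    then have "(u \<otimes> a) [^] Suc n = \<zero>" using u a by simp
    then have "u \<otimes> a = \<zero>"
      using red u(1) a unfolding reduced_ring_def by (metis DiffD1 m_closed)
    then show ?thesis
      using u(1) a by (intro bexI[of _ \<zero>] bexI[of _ u]) auto
  qed
  then show ?thesis
    unfolding localization_at_def using S.von_neumann_regular_localization_iff by blast
qed

end

theorem theorem2p2:
  fixes R :: "('a, 'r) ring_scheme"
    and E :: "('a, 'e, 'm) module_scheme"
    and \<iota> :: "'a \<Rightarrow> 'e"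
  assumes "cring R"
    and "injective_envelope R (regular_module R) E \<iota>"
  shows "tau_q_von_neumann_regular R E \<iota> \<longleftrightarrow> reduced_ring R \<and> q_dim R E \<iota> = 0"
proof -
  interpret cring R by fact
  have "\<iota> \<in> module_hom R (regular_module R) E" "inj_on \<iota> (carrier R)"
    using assms(2) by (simp_all add: injective_envelope_def essential_mono_def regular_module_def)
  then have qMax: "M \<in> q_Max R E \<iota> \<longleftrightarrow> maximal_avoiding R (finite_dense_sets R) M" for M
    by (simp add: q_Max_eq)
  then have prime: "primeideal M R" if "M \<in> q_Max R E \<iota>" for M
    using maximal_avoiding_dense_prime that by blast
  \<comment> \<open>The supremum vanishes exactly when every height does, that is, when each maximal
    q-ideal is a minimal prime.\<close>
  have dim: "q_dim R E \<iota> = 0 \<longleftrightarrow> (\<forall>p\<in>q_Max R E \<iota>. \<forall>p'. primeideal p' R \<longrightarrow> \<not> p' \<subset> p)"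
    unfolding q_dim_def using prime
    by (auto simp: Sup_enat_eq_zero_iff height_eq_zero_iff)
  show ?thesis
  proof
    assume vnr: "tau_q_von_neumann_regular R E \<iota>"
    have "x = \<zero>\<^bsub>R\<^esub>" if x: "x \<in> carrier R" "x [^]\<^bsub>R\<^esub> (n::nat) = \<zero>\<^bsub>R\<^esub>" for x n
    proof (rule ccontr)
      assume "x \<noteq> \<zero>\<^bsub>R\<^esub>"
      \<comment> \<open>The localization at this M supplies u outside M with ux = 0, but such a u
        belongs to the annihilator of x and so to M.\<close>
      then obtain M where M: "M \<in> q_Max R E \<iota>" "annihilator R {x} \<subseteq> M"
        using annihilator_subset_maximal_avoiding x(1) qMax by blast
      then obtain u where "u \<in> carrier R - M" "u \<otimes>\<^bsub>R\<^esub> x = \<zero>\<^bsub>R\<^esub>"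
        using von_neumann_regular_at_prime_nilpotent[OF prime _ x] vnr
        unfolding tau_q_von_neumann_regular_def by blast
      then show False using M(2) by (auto simp: annihilator_def)
    qed
    moreover have "q_dim R E \<iota> = 0"
      unfolding dim using vnr prime von_neumann_regular_at_prime_minimal
      by (auto simp: tau_q_von_neumann_regular_def)
    ultimately show "reduced_ring R \<and> q_dim R E \<iota> = 0"
      by (auto simp: reduced_ring_def)
  next
    assume "reduced_ring R \<and> q_dim R E \<iota> = 0"
    then show "tau_q_von_neumann_regular R E \<iota>"
      using dim prime von_neumann_regular_at_minimal_prime
      by (auto simp: tau_q_von_neumann_regular_def)
  qed
qed

end
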